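(* Let $k\geq 0$ and $n\geq 1$ be integers, let $Q_m^{(k)}$ denote the $k$th derivative of $Q_m$, and set $\Delta_{k,n}:=R\big(Q_{n+k}^{(k)}(x),Q_{n-1+k}^{(k)}(x)\big)$. Then \[ \Delta_{k,n} = \frac{2(2k+n)}{n}\left(\frac{(2k+2n)!}{n!(k+n)!}\right)^{n-2} \left(\frac{(2k+n-1)!}{(k+n-1)!}\right)^nQ_{n-1+k}^{(k)}\!\left(-\frac{n+2k}{2(n+k)}\right). \]
   Context: For each integer $m\geq 0$, $P_m(x),Q_m(x)\in\mathbb{Q}[x]$ denote the unique pair of polynomials with $\deg P_m\leq m$, $\deg Q_m\leq m$ satisfying $P_m(x)x^{m+1}+Q_m(x)(x+1)^{m+1}=1$. For polynomials $f(x)=a_0(x-\alpha_1)\cdots(x-\alpha_\mu)$ with $a_0\neq0$ and $g$, the resultant (with respect to $x$) is $R(f,g)=a_0^{\deg g}\prod_{i=1}^\mu g(\alpha_i)$; if $f=a$ is a nonzero constant, $R(a,g)=a^{\deg g}$. *)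

theory Defs
  imports Complex_Main
    "HOL-Computational_Algebra.Computational_Algebra"
    "HOL-Computational_Algebra.Field_as_Ring"
begin

definition is_PQ :: "nat \<Rightarrow> rat poly \<times> rat poly \<Rightarrow> bool" where
  "is_PQ m = (\<lambda>(P, Q). degree P \<le> m \<and> degree Q \<le> m \<and>
     P * [:0, 1:] ^ (m + 1) + Q * [:1, 1:] ^ (m + 1) = 1)"

lemma is_PQ_ex1: "\<exists>!PQ. is_PQ m PQ"
proof -
  define X :: "rat poly" where "X = [:0, 1:] ^ (m + 1)"
  define Y :: "rat poly" where "Y = [:1, 1:] ^ (m + 1)"
  have X0: "X \<noteq> 0" by (simp add: X_def)
  have dX: "degree X = m + 1" and dY: "degree Y = m + 1"
    unfolding X_def Y_def by (subst degree_power_eq; simp)+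
  have "coprime [:0, 1 :: rat:] [:1, 1:]"
  proof (rule coprimeI)
    fix c :: "rat poly" assume "c dvd [:0, 1:]" "c dvd [:1, 1:]"
    then have "c dvd [:1, 1:] - [:0, 1:]" by (rule dvd_diff[rotated])
    then show "is_unit c" by (simp add: one_pCons)
  qed
  then have cop: "coprime X Y"
    unfolding X_def Y_def by (simp only: coprime_power_left_iff coprime_power_right_iff) simp
  have iff: "is_PQ m (P, Q) \<longleftrightarrow> degree P \<le> m \<and> degree Q \<le> m \<and> P * X + Q * Y = 1" for P Q
    by (simp only: is_PQ_def X_def Y_def prod.case)
  have "\<exists>P Q. is_PQ m (P, Q)"
  proof -
    obtain a b where ab: "a * X + b * Y = 1"
      using cop bezout_coefficients_fst_snd[of X Y] by (metis coprime_iff_gcd_eq_1)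
    define Q where "Q = b mod X"
    define P where "P = a + (b div X) * Y"
    have eq: "P * X + Q * Y = 1"
    proof -
      have "P * X + Q * Y = a * X + (b div X * X + b mod X) * Y"
        by (simp only: P_def Q_def ring_distribs ac_simps)
      also have "\<dots> = 1" using ab by (simp only: div_mult_mod_eq)
      finally show ?thesis .
    qed
    have dQ: "degree Q \<le> m"
      using degree_mod_less[OF X0, of b] dX by (auto simp: Q_def)
    have "degree P \<le> m"
    proof (cases "P = 0")
      case False
      have "P * X = 1 - Q * Y" using eq by (simp add: algebra_simps)
      moreover have "degree (1 - Q * Y) \<le> m + (m + 1)"
        by (intro degree_diff_le order.trans[OF degree_mult_le]) (use dQ dY in auto)
      ultimately show ?thesis using degree_mult_eq[OF False X0] dX by simp
    qed simp
    then show ?thesis using eq dQ iff by blast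
  qed
  moreover have "P = P' \<and> Q = Q'" if "is_PQ m (P, Q)" "is_PQ m (P', Q')" for P Q P' Q'
  proof -
    have e: "(P - P') * X = (Q' - Q) * Y"
      using that unfolding iff by (simp add: algebra_simps)
    then have "X dvd (Q' - Q) * Y" by (metis dvd_triv_right)
    then have "X dvd Q' - Q" using cop by (simp add: coprime_dvd_mult_left_iff)
    moreover have "degree (Q' - Q) \<le> m"
      using that unfolding iff by (intro degree_diff_le) auto
    ultimately have "Q' - Q = 0" using dvd_imp_degree_le[of X "Q' - Q"] dX by linarith
    then show ?thesis using e X0 by auto
  qed
  ultimately show ?thesis by (metis surj_pair)
qed

definition P_poly :: "nat \<Rightarrow> rat poly" where
  "P_poly m = fst (THE PQ. is_PQ m PQ)"

definition Q_poly :: "nat \<Rightarrow> rat poly" where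
  "Q_poly m = snd (THE PQ. is_PQ m PQ)"

lemma is_PQ_P_poly_Q_poly: "is_PQ m (P_poly m, Q_poly m)"
  using theI'[OF is_PQ_ex1[of m]] by (simp add: P_poly_def Q_poly_def)

text \<open>
  The resultant \<open>R(f,g) = a\<^sub>0\<^bsup>deg g\<^esup> \<Prod> g(\<alpha>\<^sub>i)\<close> for \<open>f \<noteq> 0\<close>, where \<open>\<alpha>\<^sub>i\<close> runs through the
  complex roots of \<open>f\<close> with multiplicity. Rational polynomials are mapped into
  \<open>\<complex>[x]\<close> first, so that \<open>f\<close> splits.
\<close>
definition root_resultant :: "complex poly \<Rightarrow> complex poly \<Rightarrow> complex" where
  "root_resultant f g = lead_coeff f ^ degree g * (\<Prod>\<alpha>\<in>#proots f. poly g \<alpha>)"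

definition Delta :: "nat \<Rightarrow> nat \<Rightarrow> complex" where
  "Delta k n = root_resultant
     (map_poly of_rat ((pderiv ^^ k) (Q_poly (n + k))))
     (map_poly of_rat ((pderiv ^^ k) (Q_poly (n - 1 + k))))"

end

theory Submission
  imports Defs
begin

text \<open>
  \<open>Q\<^sub>m\<close> is the truncation of the binomial series \<open>(1 + x)\<^bsup>-(m+1)\<^esup>\<close> at degree \<open>m\<close>. Put
  \<open>f = Q\<^bsub>n+k\<^esub>\<^bsup>(k)\<^esup>\<close> and \<open>g = Q\<^bsub>n-1+k\<^esub>\<^bsup>(k)\<^esup>\<close>, let \<open>L\<close> be the leading coefficient of \<open>f\<close>, and let
  \<open>b = (n + 2k) / (n + k)\<close> and \<open>z = -b / 2\<close>. Comparing coefficients gives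
  \<open>(1 + x) f = b g + L x\<^sup>n (x - z)\<close>. Hence at a root \<open>\<alpha>\<close> of \<open>f\<close> the value \<open>g(\<alpha>)\<close> is a constant times
  \<open>\<alpha>\<^sup>n (z - \<alpha>)\<close>, and the product over all roots is expressed by \<open>f(0)\<close> and \<open>f(z)\<close>. Finally
  \<open>(1 + z) f(z) = b g(z)\<close>.
\<close>

text \<open>In formal power series, \<open>?B\<close> is the inverse of
  \<open>(1 + fps_X) ^ (m + 1)\<close>. Multiplying the defining identity by \<open>?B\<close> shows
  that \<open>?Q\<close> and \<open>?B\<close> differ by a multiple of
  \<open>fps_X ^ (m + 1)\<close>, so their coefficients agree up to index m.\<close>

lemma coeff_Q_poly:
  assumes "j \<le> m"
  shows "coeff (Q_poly m) j = (-1) ^ j * of_nat ((m + j) choose j)"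
proof -
  let ?P = "fps_of_poly (P_poly m)" and ?Q = "fps_of_poly (Q_poly m)"
  let ?B = "fps_binomial (- of_nat (m + 1)) :: rat fps"
  have "P_poly m * [:0, 1:] ^ (m + 1) + Q_poly m * [:1, 1:] ^ (m + 1) = 1"
    using is_PQ_P_poly_Q_poly[of m] by (simp add: is_PQ_def)
  then have "fps_of_poly (P_poly m * [:0, 1:] ^ (m + 1) + Q_poly m * [:1, 1:] ^ (m + 1)) = 1"
    by simp
  then have eq: "?P * fps_X ^ (m + 1) + ?Q * (1 + fps_X) ^ (m + 1) = 1"
    by (simp add: fps_of_poly_add fps_of_poly_mult fps_of_poly_power fps_of_poly_pCons del: power_Suc)
  have B: "(1 + fps_X) ^ (m + 1) * ?B = 1"
    by (metis add.right_inverse fps_binomial_0 fps_binomial_add_mult fps_binomial_of_nat)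
  have "?Q * (1 + fps_X) ^ (m + 1) = 1 - ?P * fps_X ^ (m + 1)"
    using eq by (simp only: eq_diff_eq add.commute)
  then have QB: "?Q * ((1 + fps_X) ^ (m + 1) * ?B) = (1 - ?P * fps_X ^ (m + 1)) * ?B"
    by (simp only: mult.assoc[symmetric])
  have "?Q = ?Q * ((1 + fps_X) ^ (m + 1) * ?B)" using B by simp
  also have "\<dots> = (1 - ?P * fps_X ^ (m + 1)) * ?B"
    by (rule QB)
  also have "\<dots> = ?B - fps_X ^ (m + 1) * (?P * ?B)"
    by (simp add: algebra_simps del: power_Suc)
  finally have "fps_nth ?Q j = fps_nth ?B j"
    using assms by (simp add: fps_X_power_mult_nth del: power_Suc)
  then have "coeff (Q_poly m) j = (- of_nat (m + 1)) gchoose j" by simp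
  also have "\<dots> = (-1) ^ j * (of_nat (m + j) gchoose j)"
    by (subst gbinomial_negated_upper) (simp add: algebra_simps)
  finally show ?thesis by (simp only: binomial_gbinomial)
qed

text \<open>Differentiating k times contributes the factor (j + k)! / j!, whose numerator cancels
  against the binomial coefficient of index j + k.\<close>

lemma coeff_higher_pderiv_Q_poly:
  "coeff ((pderiv ^^ k) (Q_poly (n + k))) j =
     (if j \<le> n then (-1) ^ (k + j) * fact (n + 2 * k + j) / (fact (n + k) * fact j) else 0)"
proof (cases "j \<le> n")
  case True
  have "pochhammer (of_nat (Suc j)) k = (fact (j + k) / fact j :: rat)"
    using pochhammer_product'[of "1 :: rat" j k] fact_nonzero[of j, where 'a = rat]
    by (simp add: pochhammer_fact)
  moreover have "of_nat ((n + k + (j + k)) choose (j + k)) =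
    (fact (n + 2 * k + j) / (fact (j + k) * fact (n + k)) :: rat)"
    by (subst binomial_fact) (auto simp: ac_simps mult_2_right)
  ultimately show ?thesis using True
    by (simp add: coeff_higher_pderiv coeff_Q_poly add.commute)
next
  case False
  have "degree (Q_poly (n + k)) \<le> n + k"
    using is_PQ_P_poly_Q_poly[of "n + k"] by (simp add: is_PQ_def)
  with False show ?thesis by (simp add: coeff_higher_pderiv coeff_eq_0)
qed

lemma prod_mset_proots_diff:
  fixes f :: "complex poly"
  shows "lead_coeff f * (\<Prod>\<alpha>\<in>#proots f. z - \<alpha>) = poly f z"
proof -
  have "poly f z = poly (smult (lead_coeff f) (\<Prod>\<alpha>\<in>#proots f. [:-\<alpha>, 1:])) z"
    by (simp only: complex_poly_decompose_multiset)
  also have "\<dots> = lead_coeff f * (\<Prod>\<alpha>\<in>#proots f. z - \<alpha>)"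
    by (simp add: poly_prod_mset image_mset.compositionality o_def)
  finally show ?thesis by simp
qed

lemma prod_mset_scaled_power_mult:
  fixes c :: "'b::comm_monoid_mult"
  shows "(\<Prod>x\<in>#A. c * u x ^ m * v x) = c ^ size A * (\<Prod>x\<in>#A. u x) ^ m * (\<Prod>x\<in>#A. v x)"
  by (induction A) (simp_all add: power_mult_distrib ac_simps)

text \<open>The factors - x = 0 - x and z - x turn the products over the roots into values of f at 0
  and z. Each of these m + 1 products absorbs one leading coefficient; keeping that power on the
  left avoids division.\<close>

lemma root_resultant_eqI:
  fixes f g :: "complex poly"
  assumes eq: "\<And>x. poly f x = 0 \<Longrightarrow> poly g x = c * (- x) ^ m * (z - x)"
    and f: "f \<noteq> 0"
  shows "root_resultant f g * lead_coeff f ^ (m + 1) =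
    lead_coeff f ^ degree g * c ^ degree f * poly f 0 ^ m * poly f z"
proof -
  have "(\<Prod>\<alpha>\<in>#proots f. poly g \<alpha>) = (\<Prod>\<alpha>\<in>#proots f. c * (0 - \<alpha>) ^ m * (z - \<alpha>))"
    using f by (intro arg_cong[of _ _ prod_mset] image_mset_cong) (simp add: eq)
  also have "\<dots> = c ^ size (proots f) * (\<Prod>\<alpha>\<in>#proots f. 0 - \<alpha>) ^ m
      * (\<Prod>\<alpha>\<in>#proots f. z - \<alpha>)"
    by (rule prod_mset_scaled_power_mult)
  finally have prod: "(\<Prod>\<alpha>\<in>#proots f. poly g \<alpha>) =
    c ^ degree f * (\<Prod>\<alpha>\<in>#proots f. 0 - \<alpha>) ^ m * (\<Prod>\<alpha>\<in>#proots f. z - \<alpha>)"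
    by (simp only: size_proots_complex)
  show ?thesis
    unfolding root_resultant_def prod prod_mset_proots_diff[of f, symmetric]
    by (simp only: power_mult_distrib power_add power_one_right mult_ac)
qed

lemma map_poly_of_rat_add:
  "map_poly of_rat (p + q) = (map_poly of_rat p + map_poly of_rat q :: 'a::field_char_0 poly)"
  by (rule poly_eqI) (simp add: coeff_map_poly of_rat_add)

lemma poly_map_poly_of_rat:
  "poly (map_poly of_rat p) (of_rat x) = (of_rat (poly p x) :: 'a::field_char_0)"
  by (induction p) (simp_all add: map_poly_pCons of_rat_add of_rat_mult)

text \<open>This is the identity (1 + x) f = b g + L x^n (x - z) with n shifted by one and the last
  product expanded into its two monomials.\<close>

lemma higher_pderiv_Q_poly_recurrence:
  fixes k n :: nat
  defines "f \<equiv> (pderiv ^^ k) (Q_poly (Suc n + k))" and "g \<equiv> (pderiv ^^ k) (Q_poly (n + k))"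
    and "L \<equiv> coeff ((pderiv ^^ k) (Q_poly (Suc n + k))) (Suc n)"
  shows "f + pCons 0 f = smult (of_nat (Suc n + 2 * k) / of_nat (Suc n + k)) g
    + monom (L * (of_nat (Suc n + 2 * k) / (2 * of_nat (Suc n + k)))) (Suc n) + monom L (Suc (Suc n))"
proof (rule poly_eqI)
  fix i
  let ?M = "of_nat (Suc n + k) :: rat" and ?N = "of_nat (Suc n + 2 * k) :: rat"
  \<comment> \<open>Sign and common denominator. As \<open>?s\<close> alternates, a sum of
    neighbouring coefficients of f becomes a difference of factorial quotients.\<close>
  let ?s = "\<lambda>j. (-1) ^ (k + j) / fact (Suc n + k) :: rat"
  have M: "?M \<noteq> 0" by (simp only: of_nat_eq_0_iff)
  have f: "coeff f j = (if j \<le> Suc n then ?s j * (fact (Suc n + 2 * k + j) / fact j) else 0)" for j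
    unfolding f_def coeff_higher_pderiv_Q_poly by simp
  have g: "?N / ?M * coeff g j = (if j \<le> n then ?s j * (?N * fact (n + 2 * k + j) / fact j) else 0)" for j
  proof -
    have "fact (Suc n + k) = ?M * fact (n + k)" by simp
    then show ?thesis
      unfolding g_def coeff_higher_pderiv_Q_poly
      by (simp add: ac_simps del: of_nat_Suc of_nat_add fact_Suc)
  qed
  have fact_diff: "fact (Suc n + 2 * k + Suc j) / fact (Suc j) - fact (Suc n + 2 * k + j) / fact j
      = ?N * fact (Suc n + 2 * k + j) / fact (Suc j)" for j
  proof -
    have 1: "fact (Suc n + 2 * k + Suc j) = (?N + of_nat (Suc j)) * fact (Suc n + 2 * k + j)"
      unfolding of_nat_add[symmetric] by (simp only: add_Suc_right fact_Suc)
    have 2: "fact (Suc j) = of_nat (Suc j) * (fact j :: rat)" by (rule fact_Suc)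
    have 3: "(x + y) * a / (y * b) - a / b = x * a / (y * b)" if "y \<noteq> 0" for x y a b :: rat
      using that by (simp add: distrib_right add_divide_distrib)
    show ?thesis unfolding 1 2 by (rule 3) (simp only: of_nat_eq_0_iff)
  qed
  \<comment> \<open>For j < n the right-hand side is the coefficient of the multiple of g; for j =
    n, beyond the degree of g, it is the lower monomial.\<close>
  have step: "coeff f (Suc j) + coeff f j = ?s (Suc j) * (?N * fact (Suc n + 2 * k + j) / fact (Suc j))"
    if "j \<le> n" for j
  proof -
    have "?s j = - ?s (Suc j)" by simp
    then show ?thesis
      unfolding f fact_diff[symmetric] using that by (simp only: right_diff_distrib) simp
  qed
  have L: "L * (?N / (2 * ?M)) = ?s (Suc n) * (?N * fact (Suc n + 2 * k + n) / fact (Suc n))"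
  proof -
    have "L = ?s (Suc n) * (fact (Suc (Suc n + 2 * k + n)) / fact (Suc n))"
      unfolding L_def f_def[symmetric] f by simp
    \<comment> \<open>The top factor is 2n + 2k + 2 = 2 (n + 1 + k); this is the source of the 2 in
      the denominator of z.\<close>
    also have "fact (Suc (Suc n + 2 * k + n)) = 2 * ?M * fact (Suc n + 2 * k + n)"
      unfolding fact_Suc by simp
    finally show ?thesis using M by (simp del: of_nat_Suc of_nat_add fact_Suc)
  qed
  consider "i = 0" | j where "i = Suc j" "j < n" | "i = Suc n" | j where "i = Suc j" "j > n"
    by (cases i) (use linorder_neqE_nat in blast)+
  then show "coeff (f + pCons 0 f) i =
    coeff (smult (?N / ?M) g + monom (L * (?N / (2 * ?M))) (Suc n) + monom L (Suc (Suc n))) i"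
  proof cases
    case 1
    have "coeff f 0 = ?N / ?M * coeff g 0" unfolding g unfolding f by simp
    with 1 show ?thesis by simp
  next
    case (2 j)
    then have "coeff f (Suc j) + coeff f j = ?N / ?M * coeff g (Suc j)"
      unfolding g by (subst step) simp_all
    with 2 show ?thesis by simp
  next
    case 3
    have "?N / ?M * coeff g (Suc n) = 0" unfolding g by simp
    with 3 step[of n] show ?thesis by (simp only: coeff_add coeff_smult coeff_pCons_Suc L) simp
  next
    case (4 j)
    then have "?N / ?M * coeff g (Suc j) = 0" "coeff f (Suc j) = 0"
      unfolding g unfolding f by simp_all
    \<comment> \<open>Above degree n + 1 only the shifted leading term of f survives.\<close>
    moreover have "coeff f j = (if j = Suc n then L else 0)"
    proof (cases "j = Suc n")
      case False
      with 4 show ?thesis by (simp add: f)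
    qed (simp add: L_def f_def)
    ultimately show ?thesis using 4 by (simp only: coeff_add coeff_smult coeff_pCons_Suc) simp
  qed
qed

theorem theorem6p2:
  fixes k n :: nat
  assumes "n \<ge> 1"
  shows "Delta k n = of_rat (
      2 * (2 * of_nat k + of_nat n) / of_nat n
      * (fact (2 * k + 2 * n) / (fact n * fact (k + n))) powi (int n - 2)
      * (fact (2 * k + n - 1) / fact (k + n - 1)) ^ n
      * poly ((pderiv ^^ k) (Q_poly (n - 1 + k)))
          (- ((of_nat n + 2 * of_nat k) / (2 * (of_nat n + of_nat k)))))"
proof -
  obtain p where n: "n = Suc p" using assms by (cases n) auto
  define f where "f = (pderiv ^^ k) (Q_poly (n + k))"
  define g where "g = (pderiv ^^ k) (Q_poly (n - 1 + k))"
  define F :: "complex poly" where "F = map_poly of_rat f"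
  define G :: "complex poly" where "G = map_poly of_rat g"
  define A :: rat where "A = fact (2 * k + 2 * n) / (fact n * fact (k + n))"
  \<comment> \<open>Up to sign, A is the leading coefficient of f and b B its constant term; b is
    split off because it cancels against the denominator of \<open>c\<close>.\<close>
  define B :: rat where "B = fact (2 * k + n - 1) / fact (k + n - 1)"
  define L where "L = (-1) ^ (k + n) * A"
  define b :: rat where "b = of_nat (n + 2 * k) / of_nat (n + k)"
  define z :: rat where "z = - ((of_nat n + 2 * of_nat k) / (2 * (of_nat n + of_nat k)))"
  \<comment> \<open>At a root of f the recurrence reads b g(x) = L x^n (z - x); the sign rewrites
    x^n as (- x)^n.\<close>
  define c where "c = (-1) ^ n * L / b"
  have nz: "A \<noteq> 0" "L \<noteq> 0" "b \<noteq> 0"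
    unfolding A_def L_def b_def n by (simp_all del: of_nat_Suc of_nat_add)
  have cf: "coeff f n = L" and f0: "coeff f 0 = (-1) ^ k * b * B"
    unfolding f_def coeff_higher_pderiv_Q_poly
    by (simp_all add: L_def A_def b_def B_def n ac_simps mult_2_right mult_2 del: of_nat_Suc of_nat_add)
  have df: "degree f = n"
    using nz(2) cf by (intro antisym degree_le le_degree) (simp_all add: f_def coeff_higher_pderiv_Q_poly)
  have dg: "degree g = p"
    unfolding g_def n
    by (intro antisym degree_le le_degree) (simp_all add: coeff_higher_pderiv_Q_poly)
  have rec: "f + pCons 0 f = smult b g + monom (L * (- z)) n + monom L (Suc n)"
  proof -
    have "of_nat (n + 2 * k) / (2 * of_nat (n + k)) = - z" by (simp add: z_def)
    moreover have "g = (pderiv ^^ k) (Q_poly (p + k))" by (simp add: g_def n)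
    ultimately show ?thesis
      using higher_pderiv_Q_poly_recurrence[of k p, folded n, folded f_def, unfolded cf]
      by (simp only: b_def)
  qed
  have recF: "(1 + x) * poly F x = of_rat b * poly G x + of_rat L * x ^ n * (x - of_rat z)" for x
  proof -
    have "F + pCons 0 F = map_poly of_rat (f + pCons 0 f)"
      unfolding F_def by (simp add: map_poly_of_rat_add map_poly_pCons)
    also have "\<dots> = smult (of_rat b) G + monom (of_rat (L * (- z))) n + monom (of_rat L) (Suc n)"
      unfolding rec G_def
      by (simp add: map_poly_of_rat_add map_poly_smult map_poly_monom of_rat_mult)
    finally have "poly (F + pCons 0 F) x =
        poly (smult (of_rat b) G + monom (of_rat (L * (- z))) n + monom (of_rat L) (Suc n)) x"
      by simp
    then show ?thesis by (simp add: poly_monom of_rat_mult of_rat_minus algebra_simps)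
  qed
  have lcF: "coeff F n = of_rat L" and dF: "degree F = n" and dG: "degree G = p"
    unfolding F_def G_def using cf df dg by (simp_all add: coeff_map_poly degree_map_poly)
  have F0: "poly F 0 = of_rat (coeff f 0)"
    using poly_map_poly_of_rat[of f 0] by (simp add: F_def poly_0_coeff_0)
  have Fz: "poly F (of_rat z) = of_rat (poly f z)"
    by (simp add: F_def poly_map_poly_of_rat)
  have "poly G x = of_rat c * (- x) ^ n * (of_rat z - x)" if "poly F x = 0" for x
  proof -
    have "of_rat b * poly G x = of_rat L * x ^ n * (of_rat z - x)"
      using recF[of x] that by (simp add: algebra_simps)
    moreover have "(-1) ^ n * (- x) ^ n = x ^ n"
      by (simp flip: power_mult_distrib)
    ultimately show ?thesis
      using nz(3) by (simp add: c_def of_rat_mult of_rat_divide of_rat_power of_rat_minus field_simps)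
  qed
  moreover have "F \<noteq> 0" using lcF nz(2) by auto
  ultimately have "root_resultant F G * lead_coeff F ^ (n + 1) =
      lead_coeff F ^ degree G * of_rat c ^ degree F * poly F 0 ^ n * poly F (of_rat z)"
    by (rule root_resultant_eqI)
  moreover have "Delta k n = root_resultant F G"
    by (simp only: Delta_def F_def G_def f_def g_def)
  ultimately have "Delta k n * of_rat L ^ (n + 1) =
      of_rat L ^ p * of_rat c ^ n * of_rat (coeff f 0) ^ n * of_rat (poly f z)"
    by (simp only: lcF dF dG F0 Fz)
  also have "\<dots> = of_rat (L ^ p * (c * coeff f 0) ^ n * poly f z)"
    by (simp add: of_rat_mult of_rat_power power_mult_distrib)
  finally have Delta: "Delta k n = of_rat (L ^ p * (c * coeff f 0) ^ n * poly f z / L ^ (n + 1))"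
    using nz(2) by (simp add: of_rat_divide of_rat_power eq_divide_eq del: power_Suc)
  have sq: "(-1) ^ j * (-1) ^ j = (1 :: rat)" for j by (simp flip: power_mult_distrib)
  have "c * coeff f 0 = ((-1) ^ n * (-1) ^ n) * ((-1) ^ k * (-1) ^ k) * A * B"
    using nz(3) by (simp add: c_def f0 L_def power_add mult_ac)
  then have cf0: "c * coeff f 0 = A * B" by (simp add: sq)
  \<comment> \<open>Since n + 1 = p + 2, exactly two factors L remain after cancellation, and their
    sign disappears.\<close>
  have "L ^ 2 = A ^ 2" using sq[of "k + n"] by (simp add: L_def power2_eq_square)
  then have "L ^ (n + 1) = L ^ p * A ^ 2" by (simp add: n power2_eq_square)
  then have "L ^ p * (c * coeff f 0) ^ n * poly f z / L ^ (n + 1) = A ^ n / A ^ 2 * B ^ n * poly f z"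
    using nz(2) by (simp add: cf0 power_mult_distrib)
  \<comment> \<open>For n = 1 the exponent is -1, so an integer power is needed.\<close>
  also have "A ^ n / A ^ 2 = A powi (int n - 2)"
    using nz(1) by (simp add: power_int_diff)
  finally have quot: "L ^ p * (c * coeff f 0) ^ n * poly f z / L ^ (n + 1) =
      A powi (int n - 2) * B ^ n * poly f z" .
  have fz: "poly f z = 2 * (2 * of_nat k + of_nat n) / of_nat n * poly g z"
  proof -
    have "(of_nat n :: rat) + of_nat k > 0" "(of_nat n :: rat) > 0"
      by (simp_all add: n add_pos_nonneg)
    then have z1: "1 + z = of_nat n / (2 * (of_nat n + of_nat k))" "1 + z \<noteq> 0"
      by (simp_all add: z_def field_simps)
    \<comment> \<open>At z the two monomials of \<open>rec\<close> cancel.\<close>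
    have "(1 + z) * poly f z = b * poly g z"
      using arg_cong[OF rec, of "\<lambda>q. poly q z"] by (simp add: poly_monom algebra_simps)
    then have "poly f z = b / (1 + z) * poly g z"
      using z1(2) by (simp add: eq_divide_eq mult.commute)
    also have "b / (1 + z) = 2 * (2 * of_nat k + of_nat n) / of_nat n"
    proof -
      have "x / y / (w / (2 * y)) = 2 * x / w" if "y \<noteq> 0" for x y w :: rat
        using that by simp
      from this[of "of_nat n + of_nat k" "of_nat n + 2 * of_nat k" "of_nat n"]
      show ?thesis using \<open>of_nat n + of_nat k > 0\<close> by (simp add: z1(1) b_def add.commute)
    qed
    finally show ?thesis .
  qed
  have "Delta k n = of_rat (2 * (2 * of_nat k + of_nat n) / of_nat n * A powi (int n - 2) * B ^ n
      * poly g z)"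
    unfolding Delta quot unfolding fz by (simp only: mult_ac)
  then show ?thesis unfolding A_def B_def z_def g_def .
qed

end
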